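(* Let $F:\mathbb{R}^d\to\mathbb{R}^d$ be differentiable and $L$-Lipschitz with $L>0$, and let its Jacobian $\nabla F$ be $\Lambda$-Lipschitz. Let $x^0\in\mathbb{R}^d$, let $0<\gamma\le\frac{2}{L^2+\Lambda\|F(x^0)\|}$, and let $x^{k+1}=x^k-\gamma\nabla F(x^k)^\top F(x^k)$ for $k\ge0$. Then for all $k\ge 0$ $$\|F(x^{k+1})\|\le\|F(x^k)\|,$$ and, provided $\gamma<\frac{2}{L^2+\Lambda\|F(x^0)\|}$ (so that the right-hand side below is finite), for any $K\ge0$ $$\min_{k=0,1,\ldots,K}\left\|\nabla F(x^k)^\top F(x^k)\right\|^2\le\frac{\|F(x^0)\|^2}{\gamma\left(2-\gamma\left(L^2+\Lambda\|F(x^0)\|\right)\right)(K+1)}.$$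
   Context: $\|\cdot\|$ is the Euclidean norm on vectors and the induced operator (spectral) norm on matrices. $F$ is $L$-Lipschitz if $\|F(x)-F(y)\|\le L\|x-y\|$ for all $x,y$; the Jacobian is $\Lambda$-Lipschitz, $\Lambda\ge0$, if $\|\nabla F(x)-\nabla F(y)\|\le\Lambda\|x-y\|$ for all $x,y$. No monotonicity of $F$ is assumed. The iteration is the Hamiltonian Gradient Method. *)

theory Defs
  imports "HOL-Analysis.Analysis"
begin

text \<open>
  The class norm on \<^typ>\<open>real ^ 'n ^ 'm\<close> is the Frobenius norm, so the spectral norm has to be
  introduced separately as the operator norm of matrix-vector multiplication.
\<close>

definition spectral_norm :: "real ^ 'n ^ 'm \<Rightarrow> real" where
  "spectral_norm A = onorm ((*v) A)"

end

theory Submission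
  imports Defs
begin

text \<open>
  Expand \<open>\<parallel>F (y + d)\<parallel>\<^sup>2 = \<parallel>F y\<parallel>\<^sup>2 + 2 \<langle>F y, F (y + d) - F y\<rangle> + \<parallel>F (y + d) - F y\<parallel>\<^sup>2\<close>.
  The cross term is bounded through the Lipschitz Jacobian and the last one through the
  Lipschitz constant of \<open>F\<close>, so the squared residual has at \<open>y\<close> a quadratic upper model
  of curvature \<open>L\<^sup>2 + \<Lambda> \<parallel>F y\<parallel>\<close>. Along the iteration the residual does not grow, hence
  neither does this curvature, and the decreases telescope.
\<close>

lemma norm_matrix_vector_mult_le_spectral_norm:
  fixes A :: "real ^ 'n ^ 'm"
  shows "norm (A *v v) \<le> spectral_norm A * norm v"
  unfolding spectral_norm_def
  by (rule onorm) (simp add: matrix_vector_mul_bounded_linear)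

text \<open>Pairing with a fixed \<open>u\<close> reduces the estimate to a scalar one on the
  segment from \<open>y\<close> to \<open>y + d\<close>. At parameter t the slope of
  \<open>u \<bullet> F\<close> exceeds its initial value by at most
  \<open>\<Lambda> * norm u * (norm d)\<^sup>2 * t\<close>; integrating t over [0,1] gives the
  factor 1/2.\<close>

lemma inner_increment_le_lipschitz_jacobian:
  fixes F :: "real ^ 'n \<Rightarrow> real ^ 'm"
  assumes F_diff: "\<And>y. F differentiable (at y)"
    and jac: "\<And>y z. spectral_norm (jacobian F (at y) - jacobian F (at z)) \<le> \<Lambda> * norm (y - z)"
  shows "u \<bullet> (F (y + d) - F y)
    \<le> u \<bullet> (jacobian F (at y) *v d) + \<Lambda> * norm u * (norm d)\<^sup>2 / 2"
proof -
  define J where "J z = jacobian F (at z)" for z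
  \<comment> \<open>This is the scalar function minus the linear and quadratic terms of its upper
    model. A nonincreasing \<open>\<psi>\<close> replaces the integral, and
    \<open>\<psi> 1 \<le> \<psi> 0\<close> is the claim.\<close>
  define \<psi> where "\<psi> t = u \<bullet> F (y + t *\<^sub>R d) - t * (u \<bullet> (J y *v d))
    - \<Lambda> * norm u * (norm d)\<^sup>2 * t\<^sup>2 / 2" for t
  have "\<psi> 1 \<le> \<psi> 0"
  proof (rule DERIV_nonpos_imp_nonincreasing[where f = \<psi>])
    fix t :: real
    assume t: "0 \<le> t" "t \<le> 1"
    let ?D = "u \<bullet> (J (y + t *\<^sub>R d) *v d) - u \<bullet> (J y *v d) - \<Lambda> * norm u * (norm d)\<^sup>2 * t"
    have "(F has_derivative (*v) (J z)) (at z)" for z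
      using F_diff jacobian_works unfolding J_def by blast
    then have "((\<lambda>t. F (y + t *\<^sub>R d)) has_derivative (\<lambda>s. J (y + t *\<^sub>R d) *v (s *\<^sub>R d))) (at t)"
      by (rule has_derivative_compose[rotated]) (auto intro!: derivative_eq_intros)
    then have "((\<lambda>t. u \<bullet> F (y + t *\<^sub>R d)) has_field_derivative u \<bullet> (J (y + t *\<^sub>R d) *v d)) (at t)"
      unfolding has_field_derivative_def
      by (auto intro!: derivative_eq_intros simp: matrix_vector_mult_scaleR)
    then have "(\<psi> has_field_derivative ?D) (at t)"
      unfolding \<psi>_def by (auto intro!: derivative_eq_intros)
    moreover have "?D \<le> 0"
    proof -
      have "u \<bullet> (J (y + t *\<^sub>R d) *v d) - u \<bullet> (J y *v d) = u \<bullet> ((J (y + t *\<^sub>R d) - J y) *v d)"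
        by (simp add: matrix_vector_mult_diff_rdistrib inner_diff_right)
      also have "\<dots> \<le> norm u * norm ((J (y + t *\<^sub>R d) - J y) *v d)"
        by (rule norm_cauchy_schwarz)
      also have "\<dots> \<le> norm u * (spectral_norm (J (y + t *\<^sub>R d) - J y) * norm d)"
        by (intro mult_left_mono norm_matrix_vector_mult_le_spectral_norm norm_ge_zero)
      \<comment> \<open>The two base points differ by \<open>t *\<^sub>R d\<close>, whose norm is
        \<open>t * norm d\<close> because t is nonnegative.\<close>
      also have "\<dots> \<le> norm u * ((\<Lambda> * (t * norm d)) * norm d)"
        using jac[of "y + t *\<^sub>R d" y] t
        by (intro mult_left_mono mult_right_mono) (auto simp: J_def)
      finally show ?thesis
        by (simp add: power2_eq_square mult_ac)
    qed
    ultimately show "\<exists>D. (\<psi> has_field_derivative D) (at t) \<and> D \<le> 0"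
      by blast
  qed simp
  then show ?thesis
    by (simp add: \<psi>_def J_def inner_diff_right)
qed

lemma norm_sq_quadratic_upper_bound:
  fixes F :: "real ^ 'n \<Rightarrow> real ^ 'm"
  assumes F_diff: "\<And>y. F differentiable (at y)"
    and F_lip: "L-lipschitz_on UNIV F"
    and jac: "\<And>y z. spectral_norm (jacobian F (at y) - jacobian F (at z)) \<le> \<Lambda> * norm (y - z)"
  shows "(norm (F (y + d)))\<^sup>2 \<le> (norm (F y))\<^sup>2 + 2 * (F y \<bullet> (jacobian F (at y) *v d))
    + (L\<^sup>2 + \<Lambda> * norm (F y)) * (norm d)\<^sup>2"
proof -
  have "norm (F (y + d) - F y) \<le> L * norm d"
    using lipschitz_onD[OF F_lip, of "y + d" y] by (simp add: dist_norm)
  then have "(norm (F (y + d) - F y))\<^sup>2 \<le> L\<^sup>2 * (norm d)\<^sup>2"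
    by (metis norm_ge_zero power_mono power_mult_distrib)
  moreover have "(norm (F (y + d)))\<^sup>2
      = (norm (F y))\<^sup>2 + 2 * (F y \<bullet> (F (y + d) - F y)) + (norm (F (y + d) - F y))\<^sup>2"
    by (simp add: power2_norm_eq_inner algebra_simps inner_commute)
  \<comment> \<open>With \<open>u\<close> taken as \<open>F y\<close>, the 2 in front of the cross
    term cancels the 1/2.\<close>
  ultimately show ?thesis
    using inner_increment_le_lipschitz_jacobian[OF F_diff jac, of "F y" y d]
    by (simp add: algebra_simps)
qed

text \<open>\<open>g\<close> is the gradient of half the squared residual. For the step
  \<open>- \<gamma> *\<^sub>R g y\<close> the linear term of the model is -2 \<gamma> times the
  squared norm of \<open>g y\<close>, and the quadratic term is \<gamma>^2 times the curvature times
  the same quantity.\<close>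

lemma hamiltonian_gradient_step_decrease:
  fixes F :: "real ^ 'n \<Rightarrow> real ^ 'm"
  assumes "\<And>y. F differentiable (at y)"
    and "L-lipschitz_on UNIV F"
    and "\<And>y z. spectral_norm (jacobian F (at y) - jacobian F (at z)) \<le> \<Lambda> * norm (y - z)"
  defines "g \<equiv> \<lambda>y. transpose (jacobian F (at y)) *v F y"
  shows "(norm (F (y - \<gamma> *\<^sub>R g y)))\<^sup>2
    \<le> (norm (F y))\<^sup>2 - \<gamma> * (2 - \<gamma> * (L\<^sup>2 + \<Lambda> * norm (F y))) * (norm (g y))\<^sup>2"
proof -
  \<comment> \<open>The transpose is the adjoint for the inner product.\<close>
  have "F y \<bullet> (jacobian F (at y) *v v) = g y \<bullet> v" for v
    by (metis g_def dot_lmul_matrix transpose_matrix_vector)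
  then have "F y \<bullet> (jacobian F (at y) *v (- \<gamma> *\<^sub>R g y)) = - \<gamma> * (norm (g y))\<^sup>2"
    by (simp add: power2_norm_eq_inner)
  with norm_sq_quadratic_upper_bound[OF assms(1-3), of y "- \<gamma> *\<^sub>R g y"] show ?thesis
    by (simp add: power_mult_distrib) (simp add: algebra_simps power2_eq_square)
qed

lemma Min_atLeastAtMost_le_average:
  fixes f :: "nat \<Rightarrow> real"
  shows "(MIN k\<in>{0..K}. f k) * (real K + 1) \<le> (\<Sum>k\<le>K. f k)"
proof -
  have "real (card {..K}) * (MIN k\<in>{0..K}. f k) \<le> (\<Sum>k\<le>K. f k)"
    by (rule sum_bounded_below) auto
  then show ?thesis
    by (simp add: algebra_simps)
qed

theorem theoremF4:
  fixes F :: "real ^ 'd \<Rightarrow> real ^ 'd"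
    and L \<Lambda> \<gamma> :: real
    and x :: "nat \<Rightarrow> real ^ 'd"
  assumes L_pos: "L > 0"
    and Lambda_nonneg: "\<Lambda> \<ge> 0"
    and F_diff: "\<And>y. F differentiable (at y)"
    and F_Lipschitz: "L-lipschitz_on UNIV F"
    and jacobian_Lipschitz:
      "\<And>y z. spectral_norm (jacobian F (at y) - jacobian F (at z)) \<le> \<Lambda> * norm (y - z)"
    and gamma_pos: "0 < \<gamma>"
    and gamma_le: "\<gamma> \<le> 2 / (L\<^sup>2 + \<Lambda> * norm (F (x 0)))"
    and iteration:
      "\<And>k. x (Suc k) = x k - \<gamma> *\<^sub>R (transpose (jacobian F (at (x k))) *v F (x k))"
  shows "(\<forall>k. norm (F (x (Suc k))) \<le> norm (F (x k))) \<and>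
    (\<gamma> < 2 / (L\<^sup>2 + \<Lambda> * norm (F (x 0))) \<longrightarrow>
      (\<forall>K. (MIN k\<in>{0..K}. (norm (transpose (jacobian F (at (x k))) *v F (x k)))\<^sup>2)
        \<le> (norm (F (x 0)))\<^sup>2
            / (\<gamma> * (2 - \<gamma> * (L\<^sup>2 + \<Lambda> * norm (F (x 0)))) * (real K + 1))))"
proof -
  define g where "g k = transpose (jacobian F (at (x k))) *v F (x k)" for k
  define M where "M = L\<^sup>2 + \<Lambda> * norm (F (x 0))"
  have "M > 0"
    unfolding M_def using L_pos Lambda_nonneg by (simp add: add_pos_nonneg)
  then have \<gamma>M: "\<gamma> * M \<le> 2"
    using gamma_le by (simp add: M_def field_simps)
  \<comment> \<open>The curvature at \<open>x k\<close> is replaced by its initial value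
    \<open>M\<close>, which is legitimate only while the residual has not exceeded its initial size.
    That condition is discharged later in \<open>bounded\<close>.\<close>
  have step: "(norm (F (x (Suc k))))\<^sup>2
      \<le> (norm (F (x k)))\<^sup>2 - \<gamma> * (2 - \<gamma> * M) * (norm (g k))\<^sup>2"
    if "norm (F (x k)) \<le> norm (F (x 0))" for k
  proof -
    have "L\<^sup>2 + \<Lambda> * norm (F (x k)) \<le> M"
      unfolding M_def using that Lambda_nonneg by (simp add: mult_left_mono)
    then have "\<gamma> * (2 - \<gamma> * M) * (norm (g k))\<^sup>2
        \<le> \<gamma> * (2 - \<gamma> * (L\<^sup>2 + \<Lambda> * norm (F (x k)))) * (norm (g k))\<^sup>2"
      using gamma_pos by (intro mult_right_mono mult_left_mono diff_left_mono) auto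
    with hamiltonian_gradient_step_decrease[OF F_diff F_Lipschitz jacobian_Lipschitz, of "x k" \<gamma>]
    show ?thesis
      by (simp add: iteration g_def)
  qed
  have mono: "norm (F (x (Suc k))) \<le> norm (F (x k))"
    if "norm (F (x k)) \<le> norm (F (x 0))" for k
  proof -
    have "0 \<le> \<gamma> * (2 - \<gamma> * M) * (norm (g k))\<^sup>2"
      using gamma_pos \<gamma>M by simp
    with step[OF that] have "(norm (F (x (Suc k))))\<^sup>2 \<le> (norm (F (x k)))\<^sup>2"
      by linarith
    then show ?thesis
      by (rule power2_le_imp_le) simp
  qed
  \<comment> \<open>No circularity: the bound at k yields the decrease to k+1 through
    \<open>mono\<close>, which in turn yields the bound at k+1.\<close>
  have bounded: "norm (F (x k)) \<le> norm (F (x 0))" for k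
    by (induction k) (auto intro: order_trans mono)
  have "(MIN k\<in>{0..K}. (norm (g k))\<^sup>2)
      \<le> (norm (F (x 0)))\<^sup>2 / (\<gamma> * (2 - \<gamma> * M) * (real K + 1))"
    if "\<gamma> < 2 / M" for K
  proof -
    define c where "c = \<gamma> * (2 - \<gamma> * M)"
    \<comment> \<open>The strict step size bound enters here; equality would make \<open>c\<close>
      vanish and forbid the final division.\<close>
    have "c > 0"
      using that gamma_pos \<open>M > 0\<close> by (simp add: c_def field_simps)
    have "c * (\<Sum>k\<le>K. (norm (g k))\<^sup>2)
        \<le> (\<Sum>k\<le>K. (norm (F (x k)))\<^sup>2 - (norm (F (x (Suc k))))\<^sup>2)"
      unfolding sum_distrib_left c_def using step[OF bounded]
      by (intro sum_mono) (simp add: le_diff_eq add.commute)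
    also have "\<dots> = (norm (F (x 0)))\<^sup>2 - (norm (F (x (Suc K))))\<^sup>2"
      by (rule sum_telescope)
    also have "\<dots> \<le> (norm (F (x 0)))\<^sup>2"
      by simp
    \<comment> \<open>The sum dominates its K+1 terms' minimum times K+1, which is the source of the
      factor K+1 in the rate.\<close>
    finally have "c * ((MIN k\<in>{0..K}. (norm (g k))\<^sup>2) * (real K + 1)) \<le> (norm (F (x 0)))\<^sup>2"
      using Min_atLeastAtMost_le_average[of "\<lambda>k. (norm (g k))\<^sup>2" K] \<open>c > 0\<close>
      by (meson mult_left_mono order_trans less_imp_le)
    then show ?thesis
      using \<open>c > 0\<close> unfolding c_def[symmetric] by (simp add: pos_le_divide_eq mult_ac)
  qed
  with mono bounded show ?thesis
    unfolding M_def g_def by blast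
qed

end
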